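(* Let $N\ge 2$, $d\ge 1$, let $\phi:[0,+\infty)\to\mathbb{R}$ and, for $i,j\in\{1,\dots,N\}$, let $M_{ij}:[0,+\infty)\to[0,1]$. Let $\{x_i(t)\}_{i=1}^N$, $t\ge 0$, with $x_i(t)\in\mathbb{R}^d$, be a solution of $$\dot{x}_i(t)=\frac{\lambda_i}{N}\sum_{j=1}^N M_{ij}(t)\,\phi_{ij}(t)\,(x_j(t)-x_i(t)),\qquad i\in\{1,\dots,N\},$$ with initial data $x_i(0)=\bar x_i\in\mathbb{R}^d$, where $\phi_{ij}(t)=\phi(|x_i(t)-x_j(t)|)\ge 0$ and the scaling parameters are either $\lambda_i=1$ for all $i$ (fixed weights), or $\lambda_i=\lambda_i(t)=N/\sum_{j=1}^N\phi_{ij}(t)$ for all $i$ (rescaled weights). Assume: 1. $\phi$ is Lipschitz continuous; 2. the constant $\phi_{\min}:=\min\{\phi(r): 0\le r\le \max_{i,j\in\{1,\dots,N\}}|\bar x_i-\bar x_j|\}$ satisfies $\phi_{\min}>0$; 3. every $M_{ij}$ is Lebesgue measurable. Fix $T,\mu>0$ and assume that every $M_{ij}$, $i,j\in\{1,\dots,N\}$, satisfies the persistent excitation condition $$\int_t^{t+T}M_{ij}(s)\,ds\ge\mu\qquad\text{for all } t\ge 0.$$ Then consensus holds: $$\lim_{t\to+\infty}\bigl(x_i(t)-x_j(t)\bigr)=0\qquad\text{for all } i,j\in\{1,\dots,N\}.$$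
   Context: $|\cdot|$ is the Euclidean norm on $\mathbb{R}^d$. Since the weights $M_{ij}$ are only measurable in time, a solution is understood in the Carathéodory sense: each $x_i:[0,+\infty)\to\mathbb{R}^d$ is locally absolutely continuous and the equation holds for almost every $t\ge 0$. The weights are not assumed symmetric ($M_{ij}\ne M_{ji}$ is allowed). *)

theory Defs
  imports "HOL-Analysis.Analysis"
begin

(* Absolute continuity of functions of a real variable; the library's absolutely_continuous is the
   unrelated notion for measures. The members of D are compact intervals [Inf K, Sup K] with
   disjoint interiors, so D ranges over the finite non-overlapping families of intervals in S. *)
definition abs_continuous_on :: "real set \<Rightarrow> (real \<Rightarrow> 'a::metric_space) \<Rightarrow> bool" where
  "abs_continuous_on S f \<longleftrightarrow>
     (\<forall>\<epsilon>>0. \<exists>\<delta>>0. \<forall>D. D division_of \<Union>D \<and> \<Union>D \<subseteq> S \<and> (\<Sum>K\<in>D. measure lborel K) < \<delta> \<longrightarrow>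
        (\<Sum>K\<in>D. dist (f (Inf K)) (f (Sup K))) < \<epsilon>)"

definition locally_abs_continuous_on :: "real set \<Rightarrow> (real \<Rightarrow> 'a::metric_space) \<Rightarrow> bool" where
  "locally_abs_continuous_on S f \<longleftrightarrow> (\<forall>a b. {a..b} \<subseteq> S \<longrightarrow> abs_continuous_on {a..b} f)"

definition max_dist :: "nat \<Rightarrow> (nat \<Rightarrow> 'a::real_normed_vector) \<Rightarrow> real" where
  "max_dist N y = Max ((\<lambda>(i, j). norm (y i - y j)) ` ({1..N} \<times> {1..N}))"

(* For a Lipschitz phi the infimum is attained: see phi_min_is_minimum. *)
definition phi_min :: "nat \<Rightarrow> (real \<Rightarrow> real) \<Rightarrow> (nat \<Rightarrow> 'a::real_normed_vector) \<Rightarrow> real" where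
  "phi_min N \<phi> y = Inf (\<phi> ` {0..max_dist N y})"

lemma phi_min_is_minimum:
  assumes "N \<ge> 1" and lip: "L-lipschitz_on {0..} \<phi>"
  shows "\<exists>r\<in>{0..max_dist N y}. \<phi> r = phi_min N \<phi> y \<and> (\<forall>s\<in>{0..max_dist N y}. \<phi> r \<le> \<phi> s)"
proof -
  have "norm (y 1 - y 1) \<le> max_dist N y"
    unfolding max_dist_def using assms(1) by (intro Max_ge) (auto intro!: image_eqI[of _ _ "(1, 1)"])
  then have ne: "{0..max_dist N y} \<noteq> {}" by simp
  have "continuous_on {0..max_dist N y} \<phi>"
    by (rule continuous_on_subset[OF lipschitz_on_continuous_on[OF lip]]) auto
  then obtain r where r: "r \<in> {0..max_dist N y}" "\<forall>s\<in>{0..max_dist N y}. \<phi> r \<le> \<phi> s"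
    using continuous_attains_inf[OF compact_Icc ne] by blast
  then have "phi_min N \<phi> y = \<phi> r"
    unfolding phi_min_def by (intro cInf_eq_minimum) auto
  with r show ?thesis by auto
qed

definition fixed_weights :: "nat \<Rightarrow> (nat \<Rightarrow> real \<Rightarrow> real) \<Rightarrow> bool" where
  "fixed_weights N lam \<longleftrightarrow> (\<forall>i\<in>{1..N}. \<forall>t\<ge>0. lam i t = 1)"

definition rescaled_weights ::
  "nat \<Rightarrow> (real \<Rightarrow> real) \<Rightarrow> (nat \<Rightarrow> real \<Rightarrow> 'a::real_normed_vector) \<Rightarrow> (nat \<Rightarrow> real \<Rightarrow> real) \<Rightarrow> bool" where
  "rescaled_weights N \<phi> x lam \<longleftrightarrow>
     (\<forall>i\<in>{1..N}. \<forall>t\<ge>0. lam i t = real N / (\<Sum>j=1..N. \<phi> (norm (x i t - x j t))))"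

definition caratheodory_solution ::
  "nat \<Rightarrow> (real \<Rightarrow> real) \<Rightarrow> (nat \<Rightarrow> nat \<Rightarrow> real \<Rightarrow> real) \<Rightarrow> (nat \<Rightarrow> real \<Rightarrow> real) \<Rightarrow>
    (nat \<Rightarrow> 'a::real_normed_vector) \<Rightarrow> (nat \<Rightarrow> real \<Rightarrow> 'a) \<Rightarrow> bool" where
  "caratheodory_solution N \<phi> M lam xbar x \<longleftrightarrow>
     (\<forall>i\<in>{1..N}. x i 0 = xbar i \<and> locally_abs_continuous_on {0..} (x i) \<and>
        (AE t in lebesgue. t \<ge> 0 \<longrightarrow>
           (x i has_vector_derivative
              (lam i t / real N) *\<^sub>R
                (\<Sum>j=1..N. (M i j t * \<phi> (norm (x i t - x j t))) *\<^sub>R (x j t - x i t)))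
             (at t within {0..})))"

definition persistently_excited :: "real \<Rightarrow> real \<Rightarrow> (real \<Rightarrow> real) \<Rightarrow> bool" where
  "persistently_excited T \<mu> m \<longleftrightarrow> (\<forall>t\<ge>0. (LINT s:{t..t + T}|lebesgue. m s) \<ge> \<mu>)"

end

(* Fix a direction v and follow the scalars v . x_i. They solve a linear system with nonnegative weights
   of bounded row sums, so their maximum never increases and their minimum never decreases; choosing v
   along x_i - x_j shows that distances never exceed the initial ones. Hence the weights are bounded
   below by c M_ij with c > 0 constant. Over a window of length T, the scalar that is minimal at its
   beginning stays a fixed fraction of the spread below the initial maximum K, because the gap to K
   decays at most exponentially. By persistent excitation it then pulls every other scalar below K by
   a fixed fraction of the spread, so the spread shrinks by a constant factor on every window. *)
theory Submission
  imports Defs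
begin

section \<open>Absolute continuity and the fundamental theorem of calculus\<close>

text \<open>A single short interval is already an admissible family.\<close>

lemma abs_continuous_on_imp_continuous_on:
  fixes f :: "real \<Rightarrow> 'a::metric_space"
  assumes "abs_continuous_on {a..b} f"
  shows "continuous_on {a..b} f"
  unfolding continuous_on_iff
proof (intro ballI allI impI)
  fix s \<epsilon> :: real
  assume s: "s \<in> {a..b}" and "\<epsilon> > 0"
  then obtain \<delta> where "\<delta> > 0"
    and \<delta>: "\<And>D. D division_of \<Union>D \<Longrightarrow> \<Union>D \<subseteq> {a..b} \<Longrightarrow> (\<Sum>K\<in>D. measure lborel K) < \<delta>
      \<Longrightarrow> (\<Sum>K\<in>D. dist (f (Inf K)) (f (Sup K))) < \<epsilon>"
    using assms unfolding abs_continuous_on_def by metis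
  have *: "dist (f u) (f v) < \<epsilon>" if "u \<le> v" "u \<in> {a..b}" "v \<in> {a..b}" "v - u < \<delta>" for u v
  proof -
    have "{u..v} \<noteq> {}" using that by simp
    then have "{{u..v}} division_of \<Union>{{u..v}}"
      using division_of_self[of u v] by (simp del: atLeastatMost_empty_iff)
    from \<delta>[OF this] show ?thesis using that by auto
  qed
  show "\<exists>d>0. \<forall>t\<in>{a..b}. dist t s < d \<longrightarrow> dist (f t) (f s) < \<epsilon>"
  proof (intro exI[of _ \<delta>] conjI ballI impI)
    fix t assume "t \<in> {a..b}" "dist t s < \<delta>"
    then show "dist (f t) (f s) < \<epsilon>"
      using *[of s t] *[of t s] s by (cases "s \<le> t") (auto simp: dist_commute dist_real_def)
  qed fact
qed

text \<open>Summing the increment bound over a family gives C times the variation of f plus B times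
  the total length, and both are small. With B = 0 this serves negation, shifts and inner products
  with a fixed vector; the term with B serves the product with a Lipschitz factor in
  \<open>gronwall_lower_bound\<close>.\<close>

lemma abs_continuous_on_dominated:
  fixes f :: "real \<Rightarrow> 'a::metric_space" and g :: "real \<Rightarrow> 'b::metric_space"
  assumes f: "abs_continuous_on {a..b} f" and "C \<ge> 0" "B \<ge> 0"
    and dom: "\<And>u v. u \<in> {a..b} \<Longrightarrow> v \<in> {a..b} \<Longrightarrow> u \<le> v \<Longrightarrow>
      dist (g u) (g v) \<le> C * dist (f u) (f v) + B * (v - u)"
  shows "abs_continuous_on {a..b} g"
  unfolding abs_continuous_on_def
proof (intro allI impI)
  fix \<epsilon> :: real
  assume "\<epsilon> > 0"
  then have "\<epsilon> / (2 * (C + 1)) > 0" using \<open>C \<ge> 0\<close> by simp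
  then obtain \<delta> where "\<delta> > 0"
    and \<delta>: "\<And>D. D division_of \<Union>D \<Longrightarrow> \<Union>D \<subseteq> {a..b} \<Longrightarrow> (\<Sum>K\<in>D. measure lborel K) < \<delta>
      \<Longrightarrow> (\<Sum>K\<in>D. dist (f (Inf K)) (f (Sup K))) < \<epsilon> / (2 * (C + 1))"
    using f unfolding abs_continuous_on_def by metis
  \<comment> \<open>The variation of f and the total length each get half of \<epsilon>. The
    \<open>+ 1\<close> keeps the denominators positive when C or B is 0 and makes the final
    inequality strict.\<close>
  define \<eta> where "\<eta> = min \<delta> (\<epsilon> / (2 * (B + 1)))"
  have "\<eta> > 0" unfolding \<eta>_def using \<open>\<delta> > 0\<close> \<open>\<epsilon> > 0\<close> \<open>B \<ge> 0\<close> by simp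
  have "(\<Sum>K\<in>D. dist (g (Inf K)) (g (Sup K))) < \<epsilon>"
    if D: "D division_of \<Union>D" "\<Union>D \<subseteq> {a..b}" "(\<Sum>K\<in>D. measure lborel K) < \<eta>" for D
  proof -
    have "(\<Sum>K\<in>D. dist (g (Inf K)) (g (Sup K)))
        \<le> (\<Sum>K\<in>D. C * dist (f (Inf K)) (f (Sup K)) + B * measure lborel K)"
    proof (rule sum_mono)
      fix K assume "K \<in> D"
      then obtain u v where K: "K = {u..v}" "K \<noteq> {}" "K \<subseteq> {a..b}"
        using D division_ofD[OF D(1)] by (metis Sup_upper box_real(2) order_trans)
      then have "u \<le> v" by simp
      then show "dist (g (Inf K)) (g (Sup K)) \<le> C * dist (f (Inf K)) (f (Sup K)) + B * measure lborel K"
        using dom[of u v] K by simp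
    qed
    also have "\<dots> = C * (\<Sum>K\<in>D. dist (f (Inf K)) (f (Sup K))) + B * (\<Sum>K\<in>D. measure lborel K)"
      by (simp add: sum.distrib sum_distrib_left)
    also have "\<dots> \<le> C * (\<epsilon> / (2 * (C + 1))) + B * (\<epsilon> / (2 * (B + 1)))"
      using D \<delta>[OF D(1,2)] \<open>C \<ge> 0\<close> \<open>B \<ge> 0\<close> unfolding \<eta>_def
      by (intro add_mono mult_left_mono) auto
    also have "\<dots> < \<epsilon> / 2 + \<epsilon> / 2"
      using \<open>C \<ge> 0\<close> \<open>B \<ge> 0\<close> \<open>\<epsilon> > 0\<close> by (intro add_strict_mono) (simp_all add: field_simps)
    also have "\<dots> = \<epsilon>" by simp
    finally show ?thesis .
  qed
  then show "\<exists>\<delta>>0. \<forall>D. D division_of \<Union>D \<and> \<Union>D \<subseteq> {a..b} \<and> (\<Sum>K\<in>D. measure lborel K) < \<delta> \<longrightarrow>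
      (\<Sum>K\<in>D. dist (g (Inf K)) (g (Sup K))) < \<epsilon>"
    using \<open>\<eta> > 0\<close> by blast
qed

text \<open>Absolute continuity speaks of sets of intervals, gauge integration of pairs of tags and
  intervals; this bridges the two. The intervals do not overlap and lie in U, so their total length
  is at most the measure of U.\<close>

lemma abs_continuous_on_tagged_partial_division:
  fixes f :: "real \<Rightarrow> real" and U :: "real set"
  assumes p: "p tagged_partial_division_of {a..b}"
    and sub: "\<And>t K. (t, K) \<in> p \<Longrightarrow> K \<subseteq> U"
    and U: "U \<in> lmeasurable" "measure lebesgue U < \<delta>"
    and \<delta>: "\<And>D. D division_of \<Union>D \<Longrightarrow> \<Union>D \<subseteq> {a..b} \<Longrightarrow> (\<Sum>K\<in>D. measure lborel K) < \<delta>
      \<Longrightarrow> (\<Sum>K\<in>D. dist (f (Inf K)) (f (Sup K))) < \<epsilon>"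
  shows "(\<Sum>(t, K)\<in>p. \<bar>f (Sup K) - f (Inf K)\<bar>) < \<epsilon>"
proof -
  note p' = tagged_partial_division_ofD[OF p]
  define D where "D = snd ` p"
  have D: "D division_of \<Union>D"
    unfolding D_def by (rule partial_division_of_tagged_division[OF p])
  have Dab: "\<Union>D \<subseteq> {a..b}"
    using p'(3) unfolding D_def by fastforce
  have DU: "\<Union>D \<subseteq> U"
    using sub unfolding D_def by fastforce
  have "(\<Sum>K\<in>D. measure lborel K) = measure lebesgue (\<Union>D)"
    proof -
      have "(\<Sum>K\<in>D. measure lborel K) = (\<Sum>K\<in>D. measure lebesgue K)"
      proof (rule sum.cong[OF refl])
        fix K assume "K \<in> D"
        then obtain u v where "K = cbox u v" using division_ofD(4)[OF D] by blast
        then show "measure lborel K = measure lebesgue K" by (simp add: measure_completion)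
      qed
      then show ?thesis using content_division[OF D] by simp
    qed
  also have "\<dots> \<le> measure lebesgue U"
    using DU U(1) lmeasurable_division[OF D] by (intro measure_mono_fmeasurable) auto
  finally have "(\<Sum>K\<in>D. dist (f (Inf K)) (f (Sup K))) < \<epsilon>"
    using U(2) by (intro \<delta>[OF D Dab]) simp
  moreover have "(\<Sum>(t, K)\<in>p. \<bar>f (Sup K) - f (Inf K)\<bar>) = (\<Sum>K\<in>D. dist (f (Inf K)) (f (Sup K)))"
  proof -
    \<comment> \<open>Several tags may share one interval, so passing from pairs to intervals could
      lose terms; but a shared interval is degenerate and contributes 0. The transfer lemma asks for
      the value 0 on every interval with empty interior, including the empty set, where
      \<open>Sup\<close> and \<open>Inf\<close> say nothing; hence the case distinction.\<close>
    define h where "h K = (if K = {} then 0 else \<bar>f (Sup K) - f (Inf K)\<bar>)" for K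
    have "(\<Sum>(t, K)\<in>p. h K) = sum h D"
      unfolding D_def
    proof (rule sum.over_tagged_division_lemma[OF tagged_partial_division_of_Union_self[OF p]])
      fix u v :: real assume "box u v = {}"
      then show "h (cbox u v) = 0"
        by (cases "u = v") (auto simp: h_def)
    qed
    moreover have h: "h K = \<bar>f (Sup K) - f (Inf K)\<bar>" if "(t, K) \<in> p" for t K
      using p'(2)[OF that] by (auto simp: h_def)
    then have "(\<Sum>(t, K)\<in>p. h K) = (\<Sum>(t, K)\<in>p. \<bar>f (Sup K) - f (Inf K)\<bar>)"
      by (intro sum.cong) auto
    moreover have "sum h D = (\<Sum>K\<in>D. dist (f (Inf K)) (f (Sup K)))"
      unfolding D_def using h by (intro sum.cong) (auto simp: dist_real_def abs_minus_commute)
    ultimately show ?thesis by simp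
  qed
  ultimately show ?thesis by simp
qed

text \<open>A Riemann sum of g over a fine tagged division is compared with the telescoping sum of
  the increments of f. Since g only has to lie below the derivative, an integrable lower bound can
  be integrated even where nothing is known about the integrability of the derivative
  itself.\<close>

lemma abs_continuous_on_integral_le:
  fixes f g :: "real \<Rightarrow> real"
  assumes ab: "a \<le> b" and f: "abs_continuous_on {a..b} f" and g: "(g has_integral I) {a..b}"
    and deriv: "AE t in lebesgue. t \<in> {a..b} \<longrightarrow>
      (\<exists>D\<ge>g t. (f has_real_derivative D) (at t within {a..b}))"
  shows "I \<le> f b - f a"
proof -
  obtain E where "negligible E" and E: "\<And>t. t \<in> {a..b} - E \<Longrightarrow>
      \<exists>D\<ge>g t. (f has_real_derivative D) (at t within {a..b})"
    using deriv unfolding eventually_ae_filter_negligible by blast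
  \<comment> \<open>Changing g on a null set keeps the integral, and the value 0 removes the tags in
    E from the Riemann sum.\<close>
  define g0 where "g0 t = (if t \<in> E then 0 else g t)" for t
  have g0: "(g0 has_integral I) {a..b}"
    by (rule has_integral_spike[OF \<open>negligible E\<close> _ g]) (auto simp: g0_def)
  \<comment> \<open>The three errors, in order: Riemann sum against integral, derivative estimates
    at tags outside E, increments over intervals tagged in E.\<close>
  have main: "I \<le> f b - f a + (\<epsilon> + \<epsilon> * (b - a) + \<epsilon>)" if "\<epsilon> > 0" for \<epsilon>
  proof -
    obtain \<delta> where "\<delta> > 0"
      and \<delta>: "\<And>D. D division_of \<Union>D \<Longrightarrow> \<Union>D \<subseteq> {a..b} \<Longrightarrow> (\<Sum>K\<in>D. measure lborel K) < \<delta>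
        \<Longrightarrow> (\<Sum>K\<in>D. dist (f (Inf K)) (f (Sup K))) < \<epsilon>"
      using f \<open>\<epsilon> > 0\<close> unfolding abs_continuous_on_def by metis
    obtain U where "open U" "E \<subseteq> U" and UE: "U - E \<in> lmeasurable" "emeasure lebesgue (U - E) < ennreal \<delta>"
      using sets_lebesgue_outer_open[OF negligible_imp_sets[OF \<open>negligible E\<close>] \<open>\<delta> > 0\<close>] by metis
    have "U = (U - E) \<union> E" using \<open>E \<subseteq> U\<close> by auto
    then have U_meas: "U \<in> lmeasurable"
      using UE(1) negligible_imp_measurable[OF \<open>negligible E\<close>] by (metis fmeasurable.Un)
    moreover have "measure lebesgue U = measure lebesgue (U - E)"
      using \<open>negligible E\<close> U_meas
      by (intro measure_Diff_null_set[symmetric]) (auto simp: negligible_iff_null_sets)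
    ultimately have U: "U \<in> lmeasurable" "measure lebesgue U < \<delta>"
      using UE by (simp_all add: emeasure_eq_measure2 ennreal_less_iff)
    obtain \<gamma> where "gauge \<gamma>" and \<gamma>: "\<And>p. p tagged_division_of {a..b} \<Longrightarrow> \<gamma> fine p \<Longrightarrow>
        norm ((\<Sum>(t, K)\<in>p. measure lborel K *\<^sub>R g0 t) - I) < \<epsilon>"
      using g0 \<open>\<epsilon> > 0\<close> unfolding has_integral_real by meson
    \<comment> \<open>Straddle estimate: for u \<le> t \<le> v the errors at the two endpoints are
      \<epsilon> * (v - t) and \<epsilon> * (t - u), which add up to \<epsilon> * (v - u).\<close>
    have "\<exists>r>0. t \<in> {a..b} - E \<longrightarrow> (\<forall>u v. a \<le> u \<and> u \<le> t \<and> t \<le> v \<and> v \<le> b \<and> {u..v} \<subseteq> ball t r \<longrightarrow>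
        (g t - \<epsilon>) * (v - u) \<le> f v - f u)" for t
    proof (cases "t \<in> {a..b} - E")
      case True
      then obtain D where "D \<ge> g t" and "(f has_real_derivative D) (at t within {a..b})"
        using E by blast
      then obtain r where "r > 0" and r: "\<And>s. s \<in> {a..b} \<Longrightarrow> \<bar>s - t\<bar> < r \<Longrightarrow>
          \<bar>f s - f t - D * (s - t)\<bar> \<le> \<epsilon> * \<bar>s - t\<bar>"
        unfolding has_field_derivative_def has_derivative_within_alt
        using \<open>\<epsilon> > 0\<close> by (auto simp: real_norm_def)
      have "(g t - \<epsilon>) * (v - u) \<le> f v - f u"
        if "a \<le> u \<and> u \<le> t \<and> t \<le> v \<and> v \<le> b \<and> {u..v} \<subseteq> ball t r" for u v
      proof -
        have "u \<in> {u..v}" "v \<in> {u..v}" using that by auto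
        then have "u \<in> ball t r" "v \<in> ball t r" using that by blast+
        then have "\<bar>f v - f t - D * (v - t)\<bar> \<le> \<epsilon> * (v - t)" "\<bar>f u - f t - D * (u - t)\<bar> \<le> \<epsilon> * (t - u)"
          using r[of v] r[of u] that by (auto simp: dist_real_def)
        moreover have "g t * (v - u) \<le> D * (v - u)"
          using that \<open>D \<ge> g t\<close> by (intro mult_right_mono) auto
        ultimately show ?thesis
          by (simp add: abs_le_iff algebra_simps)
      qed
      then show ?thesis using \<open>r > 0\<close> by blast
    qed (auto intro: exI[of _ 1])
    then obtain r where r: "\<And>t. r t > 0" and r_le: "\<And>t u v. t \<in> {a..b} - E \<Longrightarrow>
        a \<le> u \<Longrightarrow> u \<le> t \<Longrightarrow> t \<le> v \<Longrightarrow> v \<le> b \<Longrightarrow> {u..v} \<subseteq> ball t (r t) \<Longrightarrow> (g t - \<epsilon>) * (v - u) \<le> f v - f u"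
      by metis
    \<comment> \<open>Intervals tagged in the null set E are confined to U, where absolute continuity controls their
      contribution; the others are controlled by the derivative at their tag.\<close>
    define \<gamma>' where "\<gamma>' t = (if t \<in> E then U else ball t (r t))" for t
    have "gauge \<gamma>'"
      using \<open>open U\<close> \<open>E \<subseteq> U\<close> r by (auto simp: gauge_def \<gamma>'_def)
    with \<open>gauge \<gamma>\<close> have "gauge (\<lambda>t. \<gamma> t \<inter> \<gamma>' t)" by (rule gauge_Int)
    then obtain p where p: "p tagged_division_of {a..b}" and "(\<lambda>t. \<gamma> t \<inter> \<gamma>' t) fine p"
      by (rule fine_division_exists_real)
    then have fine: "\<gamma> fine p" "\<gamma>' fine p" by (simp_all add: fine_Int)
    define q where "q = {(t, K) \<in> p. t \<in> E}"
    have "q tagged_partial_division_of {a..b}"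
      using p unfolding tagged_division_of_def
      by (intro tagged_partial_division_subset[of p _ q]) (auto simp: q_def)
    moreover have "K \<subseteq> U" if "(t, K) \<in> q" for t K
    proof -
      have "(t, K) \<in> p" "t \<in> E" using that by (auto simp: q_def)
      then show ?thesis using fineD[OF fine(2), of t K] by (simp add: \<gamma>'_def)
    qed
    ultimately have q: "(\<Sum>(t, K)\<in>q. \<bar>f (Sup K) - f (Inf K)\<bar>) < \<epsilon>"
      by (rule abs_continuous_on_tagged_partial_division[OF _ _ U \<delta>])
    have fin: "finite p" using p by blast
    \<comment> \<open>At a tag in E the left side is 0, and the added absolute value offsets a
      possibly negative increment. So the increments of f appear for all of p and telescope.\<close>
    have "(\<Sum>(t, K)\<in>p. measure lborel K *\<^sub>R g0 t) \<le> (\<Sum>(t, K)\<in>p. (f (Sup K) - f (Inf K)) + \<epsilon> * measure lborel K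
        + (if t \<in> E then \<bar>f (Sup K) - f (Inf K)\<bar> else 0))"
    proof (rule sum_mono, clarify)
      fix t K assume tK: "(t, K) \<in> p"
      then obtain u v where K: "K = {u..v}" "t \<in> {u..v}" "{u..v} \<subseteq> {a..b}"
        using tagged_division_ofD[OF p] by (metis box_real(2))
      show "measure lborel K *\<^sub>R g0 t \<le> f (Sup K) - f (Inf K) + \<epsilon> * measure lborel K +
          (if t \<in> E then \<bar>f (Sup K) - f (Inf K)\<bar> else 0)"
      proof (cases "t \<in> E")
        case True
        have "0 \<le> \<epsilon> * measure lborel K" using \<open>\<epsilon> > 0\<close> by simp
        moreover have "0 \<le> f (Sup K) - f (Inf K) + \<bar>f (Sup K) - f (Inf K)\<bar>" by linarith
        ultimately show ?thesis using True by (simp add: g0_def)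
      next
        case False
        moreover have "{u..v} \<subseteq> ball t (r t)"
          using fineD[OF fine(2) tK] False K(1) by (simp add: \<gamma>'_def)
        ultimately have "(g t - \<epsilon>) * (v - u) \<le> f v - f u"
          using K by (intro r_le) auto
        then show ?thesis using False K by (simp add: g0_def algebra_simps)
      qed
    qed
    also have "\<dots> = (\<Sum>(t, K)\<in>p. f (Sup K) - f (Inf K)) + \<epsilon> * (\<Sum>(t, K)\<in>p. measure lborel K)
        + (\<Sum>(t, K)\<in>p. if t \<in> E then \<bar>f (Sup K) - f (Inf K)\<bar> else 0)"
      by (simp add: case_prod_unfold sum.distrib sum_distrib_left)
    also have "(\<Sum>(t, K)\<in>p. f (Sup K) - f (Inf K)) = f b - f a"
      by (rule additive_tagged_division_1[OF ab p])
    also have "(\<Sum>(t, K)\<in>p. measure lborel K) = b - a"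
      using additive_content_tagged_division[of p a b] p ab by simp
    also have "(\<Sum>(t, K)\<in>p. if t \<in> E then \<bar>f (Sup K) - f (Inf K)\<bar> else 0)
        = (\<Sum>(t, K)\<in>q. \<bar>f (Sup K) - f (Inf K)\<bar>)"
      unfolding q_def using fin by (intro sum.mono_neutral_cong_right) (auto split: if_splits)
    finally show ?thesis
      using q \<gamma>[OF p fine(1)] by (simp add: abs_less_iff)
  qed
  show ?thesis
  proof (rule field_le_epsilon)
    fix e :: real assume "e > 0"
    define \<epsilon> where "\<epsilon> = e / (2 + (b - a))"
    have "\<epsilon> > 0" unfolding \<epsilon>_def using \<open>e > 0\<close> ab by simp
    moreover have "\<epsilon> * (2 + (b - a)) = e" unfolding \<epsilon>_def using ab by simp
    then have "\<epsilon> + \<epsilon> * (b - a) + \<epsilon> = e" by (simp add: algebra_simps)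
    ultimately show "I \<le> f b - f a + e" using main[of \<epsilon>] by simp
  qed
qed

lemma abs_continuous_on_subset:
  assumes "abs_continuous_on S f" "R \<subseteq> S"
  shows "abs_continuous_on R f"
  using assms unfolding abs_continuous_on_def by (meson order_trans)

section \<open>A Gronwall inequality\<close>

text \<open>Integrating factor: the derivative of exp (A * (t - a)) * z t is at least exp (A * (t -
  a)) * \<alpha> t, hence at least \<alpha> t because \<alpha> is nonnegative and the exponential is
  at least 1. Integrate over {a..b}.\<close>

lemma gronwall_lower_bound:
  fixes z \<alpha> :: "real \<Rightarrow> real"
  assumes ab: "a \<le> b" and z: "abs_continuous_on {a..b} z" and "A \<ge> 0"
    and \<alpha>: "(\<alpha> has_integral J) {a..b}" and \<alpha>_nonneg: "\<And>t. t \<in> {a..b} \<Longrightarrow> \<alpha> t \<ge> 0"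
    and deriv: "AE t in lebesgue. t \<in> {a..b} \<longrightarrow>
      (\<exists>D\<ge>\<alpha> t - A * z t. (z has_real_derivative D) (at t within {a..b}))"
  shows "z a + J \<le> exp (A * (b - a)) * z b"
proof -
  define f where "f t = exp (A * (t - a)) * z t" for t
  define C where "C = exp (A * (b - a))"
  have "C > 0" unfolding C_def by simp
  have C: "exp (A * (t - a)) \<le> C" if "t \<in> {a..b}" for t
    unfolding C_def using that \<open>A \<ge> 0\<close> by (simp add: mult_left_mono)
  have "compact (z ` {a..b})"
    by (intro compact_continuous_image abs_continuous_on_imp_continuous_on z compact_Icc)
  then obtain Z where Z: "\<And>t. t \<in> {a..b} \<Longrightarrow> \<bar>z t\<bar> \<le> Z"
    unfolding real_norm_def[symmetric] by (metis bounded_iff compact_imp_bounded imageI)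
  then have "Z \<ge> 0" using ab abs_ge_zero by (meson atLeastAtMost_iff order_refl order_trans)
  have "abs_continuous_on {a..b} f"
  \<comment> \<open>On {a..b} the exponential is bounded by C and Lipschitz with constant C * A
    (from 1 - exp (- s) \<le> s), and z is bounded by Z.\<close>
  proof (rule abs_continuous_on_dominated[OF z])
    fix u v assume uv: "u \<in> {a..b}" "v \<in> {a..b}" "u \<le> v"
    let ?e = "\<lambda>t. exp (A * (t - a))"
    have "?e u \<le> ?e v" using uv \<open>A \<ge> 0\<close> by (simp add: mult_left_mono)
    moreover have "?e v - ?e u \<le> C * A * (v - u)"
    proof -
      have "?e v - ?e u = ?e v * (1 - exp (- (A * (v - u))))"
        by (simp add: algebra_simps flip: exp_add)
      also have "\<dots> \<le> ?e v * (A * (v - u))"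
        using exp_ge_add_one_self[of "- (A * (v - u))"] by (intro mult_left_mono) auto
      also have "\<dots> \<le> C * (A * (v - u))"
        using C[of v] uv \<open>A \<ge> 0\<close> by (intro mult_right_mono) auto
      finally show ?thesis by (simp add: mult.assoc)
    qed
    ultimately have e: "\<bar>?e u - ?e v\<bar> \<le> C * A * (v - u)" by simp
    have "dist (f u) (f v) = \<bar>?e v * (z u - z v) + z u * (?e u - ?e v)\<bar>"
      unfolding f_def dist_real_def by (simp add: algebra_simps)
    also have "\<dots> \<le> ?e v * \<bar>z u - z v\<bar> + \<bar>z u\<bar> * \<bar>?e u - ?e v\<bar>"
      by (rule order_trans[OF abs_triangle_ineq]) (simp add: abs_mult)
    also have "\<dots> \<le> C * \<bar>z u - z v\<bar> + Z * (C * A * (v - u))"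
      using C[of v] Z[of u] e uv \<open>Z \<ge> 0\<close> \<open>C > 0\<close> by (intro add_mono mult_mono) auto
    finally show "dist (f u) (f v) \<le> C * dist (z u) (z v) + (Z * C * A) * (v - u)"
      by (simp add: dist_real_def mult.assoc)
  qed (use \<open>Z \<ge> 0\<close> \<open>C > 0\<close> \<open>A \<ge> 0\<close> in auto)
  moreover have "AE t in lebesgue. t \<in> {a..b} \<longrightarrow>
      (\<exists>D\<ge>\<alpha> t. (f has_real_derivative D) (at t within {a..b}))"
    using deriv
  proof (rule eventually_mono, intro impI)
    fix t assume *: "t \<in> {a..b} \<longrightarrow> (\<exists>D\<ge>\<alpha> t - A * z t. (z has_real_derivative D) (at t within {a..b}))"
      and t: "t \<in> {a..b}"
    then obtain D where D: "D \<ge> \<alpha> t - A * z t" "(z has_real_derivative D) (at t within {a..b})"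
      by blast
    let ?e = "exp (A * (t - a))"
    have "(f has_real_derivative ?e * (D + A * z t)) (at t within {a..b})"
      unfolding f_def by (rule derivative_eq_intros refl D(2) | simp add: algebra_simps)+
    moreover have "\<alpha> t \<le> ?e * (D + A * z t)"
    proof -
      have "1 * \<alpha> t \<le> ?e * (D + A * z t)"
        using D(1) \<alpha>_nonneg[OF t] t \<open>A \<ge> 0\<close> by (intro mult_mono) auto
      then show ?thesis by simp
    qed
    ultimately show "\<exists>D\<ge>\<alpha> t. (f has_real_derivative D) (at t within {a..b})" by blast
  qed
  ultimately have "J \<le> f b - f a"
    by (rule abs_continuous_on_integral_le[OF ab _ \<alpha>])
  then show ?thesis unfolding f_def by simp
qed

section \<open>The scalar linear consensus system on a compact interval\<close>

text \<open>The weights depend on time alone: a nonlinear system fits by evaluating its weights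
  along a given solution. The interval is a parameter so that the results can be applied to
  subintervals.\<close>

locale consensus_flow =
  fixes I :: "'i set" and w :: "'i \<Rightarrow> 'i \<Rightarrow> real \<Rightarrow> real" and y :: "'i \<Rightarrow> real \<Rightarrow> real"
    and a b A :: real
  assumes finite: "finite I"
    and le: "a \<le> b"
    and weight_nonneg: "\<And>i j t. i \<in> I \<Longrightarrow> j \<in> I \<Longrightarrow> t \<in> {a..b} \<Longrightarrow> 0 \<le> w i j t"
    and weight_sum_le: "\<And>i t. i \<in> I \<Longrightarrow> t \<in> {a..b} \<Longrightarrow> (\<Sum>j\<in>I. w i j t) \<le> A"
    and abs_continuous: "\<And>i. i \<in> I \<Longrightarrow> abs_continuous_on {a..b} (y i)"
    and ode: "\<And>i. i \<in> I \<Longrightarrow> AE t in lebesgue. t \<in> {a..b} \<longrightarrow>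
      (y i has_real_derivative (\<Sum>j\<in>I. w i j t * (y j t - y i t))) (at t within {a..b})"
begin

lemma subinterval:
  assumes "a \<le> a'" "a' \<le> b'" "b' \<le> b"
  shows "consensus_flow I w y a' b' A"
proof
  have sub: "{a'..b'} \<subseteq> {a..b}" using assms by auto
  show "abs_continuous_on {a'..b'} (y i)" if "i \<in> I" for i
    using abs_continuous[OF that] sub by (rule abs_continuous_on_subset)
  show "AE t in lebesgue. t \<in> {a'..b'} \<longrightarrow>
      (y i has_real_derivative (\<Sum>j\<in>I. w i j t * (y j t - y i t))) (at t within {a'..b'})"
    if "i \<in> I" for i
    using ode[OF that] by (rule eventually_mono) (use sub in \<open>auto intro: DERIV_subset\<close>)
qed (use assms finite weight_nonneg weight_sum_le in auto)

text \<open>Linearity in y; it turns upper bounds into lower bounds.\<close>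

lemma reflect: "consensus_flow I w (\<lambda>i t. - y i t) a b A"
proof
  show "abs_continuous_on {a..b} (\<lambda>t. - y i t)" if "i \<in> I" for i
    by (rule abs_continuous_on_dominated[OF abs_continuous[OF that], of 1 0])
      (auto simp: dist_real_def)
  show "AE t in lebesgue. t \<in> {a..b} \<longrightarrow> ((\<lambda>t. - y i t) has_real_derivative
      (\<Sum>j\<in>I. w i j t * (- y j t - - y i t))) (at t within {a..b})" if "i \<in> I" for i
    using ode[OF that]
  proof (rule eventually_mono, intro impI)
    fix t assume "t \<in> {a..b} \<longrightarrow>
        (y i has_real_derivative (\<Sum>j\<in>I. w i j t * (y j t - y i t))) (at t within {a..b})" "t \<in> {a..b}"
    then have "((\<lambda>t. - y i t) has_real_derivative - (\<Sum>j\<in>I. w i j t * (y j t - y i t))) (at t within {a..b})"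
      by (intro DERIV_minus) simp
    then show "((\<lambda>t. - y i t) has_real_derivative (\<Sum>j\<in>I. w i j t * (- y j t - - y i t))) (at t within {a..b})"
      by (simp add: algebra_simps flip: sum_negf)
  qed
qed (use finite le weight_nonneg weight_sum_le in auto)

text \<open>The gaps K - y k are nonnegative, and the derivative of the gap of i is the sum of w i k
  times the gap of k, minus the row sum times the gap of i. Keeping only k = j and bounding the row
  sum by A leaves the hypothesis of \<open>gronwall_lower_bound\<close>. With \<alpha> = 0 it says
  that a gap decays at most exponentially; a positive \<alpha> measures the pull of j on i.\<close>

lemma gap_lower_bound:
  assumes i: "i \<in> I" and j: "j \<in> I"
    and K: "\<And>k t. k \<in> I \<Longrightarrow> t \<in> {a..b} \<Longrightarrow> y k t \<le> K"
    and \<alpha>: "(\<alpha> has_integral J) {a..b}" and \<alpha>_nonneg: "\<And>t. t \<in> {a..b} \<Longrightarrow> \<alpha> t \<ge> 0"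
    and \<alpha>_le: "\<And>t. t \<in> {a..b} \<Longrightarrow> \<alpha> t \<le> w i j t * (K - y j t)"
  shows "K - y i a + J \<le> exp (A * (b - a)) * (K - y i b)"
proof (rule gronwall_lower_bound[OF le _ _ \<alpha> \<alpha>_nonneg])
  show "abs_continuous_on {a..b} (\<lambda>t. K - y i t)"
    by (rule abs_continuous_on_dominated[OF abs_continuous[OF i], of 1 0]) (auto simp: dist_real_def)
  have "0 \<le> (\<Sum>j\<in>I. w i j a)" using le i by (intro sum_nonneg weight_nonneg) auto
  also have "\<dots> \<le> A" using le i by (intro weight_sum_le) auto
  finally show "A \<ge> 0" .
  show "AE t in lebesgue. t \<in> {a..b} \<longrightarrow> (\<exists>D\<ge>\<alpha> t - A * (K - y i t).
      ((\<lambda>t. K - y i t) has_real_derivative D) (at t within {a..b}))"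
    using ode[OF i]
  proof (rule eventually_mono, intro impI)
    fix t
    let ?D = "\<Sum>k\<in>I. w i k t * (y k t - y i t)"
    assume *: "t \<in> {a..b} \<longrightarrow> (y i has_real_derivative ?D) (at t within {a..b})" and t: "t \<in> {a..b}"
    have "((\<lambda>t. K - y i t) has_real_derivative - ?D) (at t within {a..b})"
      using DERIV_diff[OF DERIV_const[of K] *[rule_format, OF t]] by simp
    moreover have "\<alpha> t - A * (K - y i t) \<le> - ?D"
    proof -
      have "\<alpha> t \<le> w i j t * (K - y j t)" by (rule \<alpha>_le[OF t])
      also have "\<dots> \<le> (\<Sum>k\<in>I. w i k t * (K - y k t))"
        using finite i j t weight_nonneg K by (intro member_le_sum) auto
      finally have "\<alpha> t \<le> (\<Sum>k\<in>I. w i k t * (K - y k t))" .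
      moreover have "(\<Sum>k\<in>I. w i k t) * (K - y i t) \<le> A * (K - y i t)"
        using weight_sum_le[OF i t] K[OF i t] by (intro mult_right_mono) auto
      moreover have "- ?D = (\<Sum>k\<in>I. w i k t * (K - y k t)) - (\<Sum>k\<in>I. w i k t) * (K - y i t)"
        by (simp add: algebra_simps sum_subtractf sum_distrib_left)
      ultimately show ?thesis by linarith
    qed
    ultimately show "\<exists>D\<ge>\<alpha> t - A * (K - y i t).
        ((\<lambda>t. K - y i t) has_real_derivative D) (at t within {a..b})" by blast
  qed
qed

text \<open>The equation may fail at the very time of a maximum, since it holds only almost
  everywhere; the exponential gap estimate replaces a sign argument for the derivative.\<close>

lemma max_principle:
  assumes init: "\<And>k. k \<in> I \<Longrightarrow> y k a \<le> K" and i: "i \<in> I" and t: "t \<in> {a..b}"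
  shows "y i t \<le> K"
proof -
  have "\<exists>s\<in>{a..b}. \<forall>t\<in>{a..b}. y k t \<le> y k s" if "k \<in> I" for k
    using le abs_continuous_on_imp_continuous_on[OF abs_continuous[OF that]]
    by (intro continuous_attains_sup) auto
  then obtain s where s: "\<And>k. k \<in> I \<Longrightarrow> s k \<in> {a..b}"
    and s_max: "\<And>k t. k \<in> I \<Longrightarrow> t \<in> {a..b} \<Longrightarrow> y k t \<le> y k (s k)" by metis
  \<comment> \<open>With K' the maximum of all y k over the whole interval, attained by y m at time s m, the gap K' - y m
    vanishes at s m; as it decays at most exponentially, it vanishes already at time a.\<close>
  have "Max ((\<lambda>k. y k (s k)) ` I) \<in> (\<lambda>k. y k (s k)) ` I"
    using finite i by (intro Max_in) auto
  then obtain m where m: "m \<in> I" "y m (s m) = Max ((\<lambda>k. y k (s k)) ` I)" by auto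
  have top: "y k t \<le> y m (s m)" if "k \<in> I" "t \<in> {a..b}" for k t
    using s_max[OF that] finite that(1) unfolding m(2) by (meson Max_ge finite_imageI imageI order_trans)
  interpret sub: consensus_flow I w y a "s m" A
    using s[OF m(1)] by (intro subinterval) auto
  have "y m (s m) - y m a + 0 \<le> exp (A * (s m - a)) * (y m (s m) - y m (s m))"
  proof (rule sub.gap_lower_bound[OF m(1) m(1), where \<alpha> = "\<lambda>_. 0"])
    show "y k t \<le> y m (s m)" if "k \<in> I" "t \<in> {a..s m}" for k t
      using that s[OF m(1)] by (intro top) auto
    then show "0 \<le> w m m t * (y m (s m) - y m t)" if "t \<in> {a..s m}" for t
      using that sub.weight_nonneg m(1) by simp
  qed auto
  then show ?thesis using top[OF i t] init[OF m(1)] by simp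
qed

lemma min_principle:
  assumes "\<And>k. k \<in> I \<Longrightarrow> K \<le> y k a" and "i \<in> I" and "t \<in> {a..b}"
  shows "K \<le> y i t"
proof -
  interpret reflected: consensus_flow I w "\<lambda>i t. - y i t" a b A by (rule reflect)
  show ?thesis using reflected.max_principle[of "- K" i t] assms by simp
qed

text \<open>Two uses of \<open>gap_lower_bound\<close>. With \<alpha> = 0, the gap of j stays at
  least h on the whole interval. Then \<alpha> * h lies below the pull of j on i, and integrating it
  opens a gap of i. Each use costs one factor exp (- A * (b - a)).\<close>

lemma pull_down:
  assumes i: "i \<in> I" and j: "j \<in> I" and init: "\<And>k. k \<in> I \<Longrightarrow> y k a \<le> K"
    and \<alpha>: "(\<alpha> has_integral J) {a..b}" and "J \<ge> \<kappa>"
    and \<alpha>_bounds: "\<And>t. t \<in> {a..b} \<Longrightarrow> 0 \<le> \<alpha> t \<and> \<alpha> t \<le> w i j t"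
  shows "y i b \<le> K - \<kappa> * exp (- 2 * A * (b - a)) * (K - y j a)"
proof -
  have K: "y k t \<le> K" if "k \<in> I" "t \<in> {a..b}" for k t
    by (rule max_principle[OF init that])
  have "0 \<le> (\<Sum>j\<in>I. w i j a)" using le i by (intro sum_nonneg weight_nonneg) auto
  also have "\<dots> \<le> A" using le i by (intro weight_sum_le) auto
  finally have "A \<ge> 0" .
  define h where "h = exp (- (A * (b - a))) * (K - y j a)"
  have "h \<ge> 0" unfolding h_def using K[OF j, of a] le by simp
  have h: "h \<le> K - y j t" if t: "t \<in> {a..b}" for t
  proof -
    interpret sub: consensus_flow I w y a t A
      using t by (intro subinterval) auto
    have "K - y j a + 0 \<le> exp (A * (t - a)) * (K - y j t)"
    proof (rule sub.gap_lower_bound[OF j j, where \<alpha> = "\<lambda>_. 0"])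
      show "y k s \<le> K" if "k \<in> I" "s \<in> {a..t}" for k s
        using that t by (intro K) auto
      then show "0 \<le> w j j s * (K - y j s)" if "s \<in> {a..t}" for s
        using that sub.weight_nonneg j by simp
    qed auto
    also have "\<dots> \<le> exp (A * (b - a)) * (K - y j t)"
      using t K[OF j t] \<open>A \<ge> 0\<close> by (intro mult_right_mono) (auto intro: mult_left_mono)
    finally have "h \<le> exp (- (A * (b - a))) * (exp (A * (b - a)) * (K - y j t))"
      unfolding h_def by (intro mult_left_mono) auto
    then show ?thesis by (simp flip: mult.assoc exp_add)
  qed
  have "K - y i a + J * h \<le> exp (A * (b - a)) * (K - y i b)"
  proof (rule gap_lower_bound[OF i j K])
    show "((\<lambda>t. \<alpha> t * h) has_integral J * h) {a..b}"
      by (rule has_integral_mult_left[OF \<alpha>])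
    show "0 \<le> \<alpha> t * h" if "t \<in> {a..b}" for t
      using \<alpha>_bounds[OF that] \<open>h \<ge> 0\<close> by simp
    show "\<alpha> t * h \<le> w i j t * (K - y j t)" if "t \<in> {a..b}" for t
      using \<alpha>_bounds[OF that] h[OF that] \<open>h \<ge> 0\<close> by (intro mult_mono) auto
  qed
  moreover have "\<kappa> * h \<le> J * h" using \<open>J \<ge> \<kappa>\<close> \<open>h \<ge> 0\<close> by (rule mult_right_mono)
  moreover have "y i a \<le> K" using i by (rule init)
  ultimately have "\<kappa> * h \<le> exp (A * (b - a)) * (K - y i b)" by simp
  then have "exp (- (A * (b - a))) * (\<kappa> * h)
      \<le> exp (- (A * (b - a))) * (exp (A * (b - a)) * (K - y i b))"
    by (intro mult_left_mono) auto
  also have "\<dots> = K - y i b" by (simp flip: mult.assoc exp_add)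
  also have "exp (- (A * (b - a))) * (\<kappa> * h) = \<kappa> * exp (- 2 * A * (b - a)) * (K - y j a)"
  proof -
    have "exp (- 2 * A * (b - a)) = exp (- (A * (b - a))) * exp (- (A * (b - a)))"
      by (simp flip: exp_add)
    then show ?thesis unfolding h_def by simp
  qed
  finally show ?thesis by simp
qed

lemma obtain_extremes:
  assumes "i \<in> I"
  obtains p q where "p \<in> I" "q \<in> I" "\<And>k. k \<in> I \<Longrightarrow> y k a \<le> y p a" "\<And>k. k \<in> I \<Longrightarrow> y q a \<le> y k a"
proof -
  have "Max ((\<lambda>k. y k a) ` I) \<in> (\<lambda>k. y k a) ` I" "Min ((\<lambda>k. y k a) ` I) \<in> (\<lambda>k. y k a) ` I"
    using finite assms by (intro Max_in Min_in; auto)+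
  then obtain p q where "p \<in> I" "Max ((\<lambda>k. y k a) ` I) = y p a" "q \<in> I" "Min ((\<lambda>k. y k a) ` I) = y q a"
    by auto
  then show ?thesis
    using that[of p q] finite by (metis Max_ge Min_le finite_imageI imageI)
qed

text \<open>The largest scalar cannot rise and the smallest cannot fall. \<Delta> is any bound on
  the initial differences, so that geometric bounds can be inserted.\<close>

lemma spread_le:
  assumes "\<And>i j. i \<in> I \<Longrightarrow> j \<in> I \<Longrightarrow> y i a - y j a \<le> \<Delta>" and "i \<in> I" "j \<in> I" "t \<in> {a..b}"
  shows "y i t - y j t \<le> \<Delta>"
proof -
  obtain p q where pq: "p \<in> I" "q \<in> I" "\<And>k. k \<in> I \<Longrightarrow> y k a \<le> y p a" "\<And>k. k \<in> I \<Longrightarrow> y q a \<le> y k a"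
    using obtain_extremes[OF assms(2)] by blast
  have "y i t \<le> y p a" by (rule max_principle[OF pq(3) assms(2,4)])
  moreover have "y q a \<le> y j t" by (rule min_principle[OF pq(4) assms(3,4)])
  ultimately show ?thesis using assms(1)[OF pq(1,2)] by simp
qed

text \<open>The initially smallest scalar q pulls every y i below the initial maximum, while every y
  j stays above the initial minimum. Excitation is assumed for all pairs because q varies with the
  window. The condition on \<kappa> keeps the contraction factor nonnegative, so that the true
  spread may be replaced by \<Delta>.\<close>

lemma spread_contraction:
  assumes spread: "\<And>i j. i \<in> I \<Longrightarrow> j \<in> I \<Longrightarrow> y i a - y j a \<le> \<Delta>"
    and excited: "\<And>i j. i \<in> I \<Longrightarrow> j \<in> I \<Longrightarrow>
      \<exists>\<alpha> J. (\<alpha> has_integral J) {a..b} \<and> J \<ge> \<kappa> \<and> (\<forall>t\<in>{a..b}. 0 \<le> \<alpha> t \<and> \<alpha> t \<le> w i j t)"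
    and \<kappa>: "\<kappa> * exp (- 2 * A * (b - a)) \<le> 1" and i: "i \<in> I" and j: "j \<in> I"
  shows "y i b - y j b \<le> (1 - \<kappa> * exp (- 2 * A * (b - a))) * \<Delta>"
proof -
  obtain p q where pq: "p \<in> I" "q \<in> I" "\<And>k. k \<in> I \<Longrightarrow> y k a \<le> y p a" "\<And>k. k \<in> I \<Longrightarrow> y q a \<le> y k a"
    using obtain_extremes[OF i] by blast
  obtain \<alpha> J where \<alpha>: "(\<alpha> has_integral J) {a..b}" "J \<ge> \<kappa>"
    "\<And>t. t \<in> {a..b} \<Longrightarrow> 0 \<le> \<alpha> t \<and> \<alpha> t \<le> w i q t"
    using excited[OF i pq(2)] by blast
  have "y i b \<le> y p a - \<kappa> * exp (- 2 * A * (b - a)) * (y p a - y q a)"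
    by (rule pull_down[OF i pq(2,3) \<alpha>])
  moreover have "y q a \<le> y j b"
    using le by (intro min_principle[OF pq(4) j]) auto
  moreover have "(1 - \<kappa> * exp (- 2 * A * (b - a))) * (y p a - y q a)
      \<le> (1 - \<kappa> * exp (- 2 * A * (b - a))) * \<Delta>"
    using \<kappa> spread[OF pq(1,2)] by (intro mult_left_mono) auto
  moreover have "(1 - e) * d = d - e * d" for e d :: real by (simp add: algebra_simps)
  ultimately show ?thesis by (smt (verit))
qed

end

section \<open>Geometric decay over successive windows\<close>

text \<open>A, T and \<kappa> are the same for all windows, hence so is the contraction factor
  \<rho>. This gives \<rho> ^ n * \<Delta> at time n * T, and \<open>spread_le\<close> carries the
  bound to all later times.\<close>

lemma consensus_flow_tendsto:
  assumes flow: "\<And>a b. 0 \<le> a \<Longrightarrow> a \<le> b \<Longrightarrow> consensus_flow I w y a b A"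
    and "T > 0" "\<kappa> > 0"
    and excited: "\<And>i j t. i \<in> I \<Longrightarrow> j \<in> I \<Longrightarrow> t \<ge> 0 \<Longrightarrow>
      \<exists>\<alpha> J. (\<alpha> has_integral J) {t..t + T} \<and> J \<ge> \<kappa> \<and> (\<forall>s\<in>{t..t + T}. 0 \<le> \<alpha> s \<and> \<alpha> s \<le> w i j s)"
    and i: "i \<in> I" and j: "j \<in> I"
  shows "((\<lambda>t. y i t - y j t) \<longlongrightarrow> 0) at_top"
proof -
  \<comment> \<open>The cap ensures \<kappa>' * exp (- 2 * A * T) \<le> 1, as
    \<open>spread_contraction\<close> requires; a smaller constant only weakens the
    excitation.\<close>
  define \<kappa>' where "\<kappa>' = min \<kappa> (exp (2 * A * T))"
  define \<rho> where "\<rho> = 1 - \<kappa>' * exp (- 2 * A * T)"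
  have "\<kappa>' > 0" unfolding \<kappa>'_def using \<open>\<kappa> > 0\<close> by simp
  have "\<kappa>' * exp (- 2 * A * T) \<le> exp (2 * A * T) * exp (- 2 * A * T)"
    unfolding \<kappa>'_def by (intro mult_right_mono) auto
  then have le1: "\<kappa>' * exp (- 2 * A * T) \<le> 1" by (simp flip: exp_add)
  have \<rho>: "0 \<le> \<rho>" "\<rho> < 1" using le1 \<open>\<kappa>' > 0\<close> unfolding \<rho>_def by auto
  have "finite I" using flow[of 0 0] consensus_flow.finite by auto
  define \<Delta> where "\<Delta> = Max ((\<lambda>(i, j). y i 0 - y j 0) ` (I \<times> I))"
  have \<Delta>: "y i 0 - y j 0 \<le> \<Delta>" if "i \<in> I" "j \<in> I" for i j
    unfolding \<Delta>_def using that \<open>finite I\<close> by (intro Max_ge) (auto intro!: image_eqI[of _ _ "(i, j)"])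
  have step: "y i (real n * T) - y j (real n * T) \<le> \<rho> ^ n * \<Delta>" if "i \<in> I" "j \<in> I" for i j n
    using that
  proof (induction n arbitrary: i j)
    case 0
    then show ?case using \<Delta> by simp
  next
    case (Suc n)
    interpret consensus_flow I w y "real n * T" "real n * T + T" A
      using \<open>T > 0\<close> by (intro flow) auto
    have "y i (real n * T + T) - y j (real n * T + T)
        \<le> (1 - \<kappa>' * exp (- 2 * A * (real n * T + T - real n * T))) * (\<rho> ^ n * \<Delta>)"
    proof (rule spread_contraction[OF Suc.IH])
      show "\<exists>\<alpha> J. (\<alpha> has_integral J) {real n * T..real n * T + T} \<and> \<kappa>' \<le> J \<and>
          (\<forall>t\<in>{real n * T..real n * T + T}. 0 \<le> \<alpha> t \<and> \<alpha> t \<le> w i j t)" if "i \<in> I" "j \<in> I" for i j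
      proof -
        have "real n * T \<ge> 0" using \<open>T > 0\<close> by simp
        then show ?thesis
          using excited[OF that, of "real n * T"] unfolding \<kappa>'_def by (meson min.coboundedI1)
      qed
    qed (use le1 Suc.prems in auto)
    then show ?case by (simp add: \<rho>_def algebra_simps)
  qed
  have bound: "y i t - y j t \<le> \<rho> ^ n * \<Delta>" if "i \<in> I" "j \<in> I" "t \<ge> real n * T" for i j n t
  proof -
    interpret consensus_flow I w y "real n * T" t A
      using \<open>T > 0\<close> that by (intro flow) auto
    show ?thesis using that by (intro spread_le[OF step]) auto
  qed
  show ?thesis
  proof (rule tendstoI)
    fix \<epsilon> :: real assume "\<epsilon> > 0"
    have "(\<lambda>n. \<rho> ^ n * \<Delta>) \<longlonglongrightarrow> 0 * \<Delta>"
      using \<rho> by (intro tendsto_mult_right LIMSEQ_realpow_zero) auto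
    then have "eventually (\<lambda>n. \<rho> ^ n * \<Delta> < \<epsilon>) sequentially"
      using \<open>\<epsilon> > 0\<close> by (intro order_tendstoD) auto
    then obtain n where "\<rho> ^ n * \<Delta> < \<epsilon>" by (meson eventually_happens sequentially_bot)
    then have "dist (y i t - y j t) 0 < \<epsilon>" if "t \<ge> real n * T" for t
      using bound[OF i j that] bound[OF j i that] by (auto simp: dist_real_def)
    then show "\<forall>\<^sub>F t in at_top. dist (y i t - y j t) 0 < \<epsilon>"
      by (meson eventually_at_top_linorder)
  qed
qed

section \<open>Consensus for the nonlinear system\<close>

theorem theoremI1:
  fixes N :: nat
    and \<phi> :: "real \<Rightarrow> real"
    and M :: "nat \<Rightarrow> nat \<Rightarrow> real \<Rightarrow> real"
    and lam :: "nat \<Rightarrow> real \<Rightarrow> real"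
    and xbar :: "nat \<Rightarrow> real ^ 'd"
    and x :: "nat \<Rightarrow> real \<Rightarrow> real ^ 'd"
    and T \<mu> :: real
  assumes "N \<ge> 2"
    and "\<forall>i\<in>{1..N}. \<forall>j\<in>{1..N}. \<forall>t\<ge>0. M i j t \<in> {0..1}"
    and "caratheodory_solution N \<phi> M lam xbar x"
    and "\<forall>i\<in>{1..N}. \<forall>j\<in>{1..N}. \<forall>t\<ge>0. \<phi> (norm (x i t - x j t)) \<ge> 0"
    and "fixed_weights N lam \<or> rescaled_weights N \<phi> x lam"
    and "\<exists>L. L-lipschitz_on {0..} \<phi>"
    and "phi_min N \<phi> xbar > 0"
    and "\<forall>i\<in>{1..N}. \<forall>j\<in>{1..N}. M i j \<in> borel_measurable (lebesgue_on {0..})"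
    and "T > 0" and "\<mu> > 0"
    and "\<forall>i\<in>{1..N}. \<forall>j\<in>{1..N}. persistently_excited T \<mu> (M i j)"
  shows "\<forall>i\<in>{1..N}. \<forall>j\<in>{1..N}. ((\<lambda>t. x i t - x j t) \<longlongrightarrow> 0) at_top"
proof -
  define I where "I = {1..N}"
  have "finite I" "1 \<in> I" unfolding I_def using assms(1) by auto
  have "real N > 0" using assms(1) by simp
  obtain L where L: "L-lipschitz_on {0..} \<phi>" using assms(6) by blast
  then have "L \<ge> 0" by (rule lipschitz_on_nonneg)
  define R where "R = max_dist N xbar"
  define pm where "pm = phi_min N \<phi> xbar"
  have "pm > 0" unfolding pm_def by (rule assms(7))
  have pm_le: "pm \<le> \<phi> r" if "0 \<le> r" "r \<le> R" for r
    using phi_min_is_minimum[OF _ L, of N xbar] assms(1) that unfolding pm_def R_def by fastforce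
  \<comment> \<open>Bounds the row sums under both scalings: the Lipschitz bound on \<phi> over
    distances up to r serves the fixed weights, the 1 serves the rescaled ones.\<close>
  define B where "B r = max 1 (\<phi> 0 + L * r)" for r
  have phi_le: "\<phi> r \<le> B s" if "0 \<le> r" "r \<le> s" for r s
  proof -
    have "\<phi> r - \<phi> 0 \<le> L * r"
      using lipschitz_onD[OF L, of r 0] that by (simp add: dist_real_def)
    also have "\<dots> \<le> L * s" using that \<open>L \<ge> 0\<close> by (intro mult_left_mono)
    finally show ?thesis unfolding B_def by simp
  qed
  define \<psi> where "\<psi> i j t = \<phi> (norm (x i t - x j t))" for i j t
  define w where "w i j t = lam i t / real N * (M i j t * \<psi> i j t)" for i j t
  have \<psi>: "\<psi> i j t \<ge> 0" if "i \<in> I" "j \<in> I" "t \<ge> 0" for i j t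
    using assms(4) that unfolding \<psi>_def I_def by blast
  have M: "0 \<le> M i j t" "M i j t \<le> 1" if "i \<in> I" "j \<in> I" "t \<ge> 0" for i j t
    using assms(2) that unfolding I_def by auto
  have lam: "lam i t / real N = 1 / real N \<or> lam i t / real N = 1 / (\<Sum>j\<in>I. \<psi> i j t)"
    if "i \<in> I" "t \<ge> 0" for i t
    using assms(5) that \<open>real N > 0\<close> unfolding fixed_weights_def rescaled_weights_def I_def \<psi>_def by auto
  have w_nonneg: "0 \<le> w i j t" if "i \<in> I" "j \<in> I" "t \<ge> 0" for i j t
  proof -
    have "0 \<le> (\<Sum>j\<in>I. \<psi> i j t)" using \<psi> that by (intro sum_nonneg)
    then have "0 \<le> lam i t / real N" using lam[of i t] that by auto
    then show ?thesis unfolding w_def using M \<psi> that by (intro mult_nonneg_nonneg) auto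
  qed
  have w_sum: "(\<Sum>j\<in>I. w i j t) \<le> B s"
    if i: "i \<in> I" and t: "t \<ge> 0" and dist: "\<And>i j. i \<in> I \<Longrightarrow> j \<in> I \<Longrightarrow> norm (x i t - x j t) \<le> s" for i t s
  proof -
    have eq: "(\<Sum>j\<in>I. w i j t) = lam i t / real N * (\<Sum>j\<in>I. M i j t * \<psi> i j t)"
      unfolding w_def by (simp add: sum_distrib_left)
    have M\<psi>_le: "(\<Sum>j\<in>I. M i j t * \<psi> i j t) \<le> (\<Sum>j\<in>I. \<psi> i j t)"
      using M \<psi> i t by (intro sum_mono mult_left_le_one_le) auto
    consider "lam i t / real N = 1 / real N" | "lam i t / real N = 1 / (\<Sum>j\<in>I. \<psi> i j t)"
      using lam i t by blast
    then show ?thesis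
    proof cases
      case 1
      have "(\<Sum>j\<in>I. \<psi> i j t) \<le> real (card I) * B s"
        using dist i unfolding \<psi>_def by (intro sum_bounded_above phi_le) auto
      then have "(\<Sum>j\<in>I. \<psi> i j t) \<le> real N * B s" by (simp add: I_def)
      then show ?thesis
        using M\<psi>_le \<open>real N > 0\<close> unfolding eq 1 by (simp add: divide_simps mult.commute)
    next
      case 2
      \<comment> \<open>The sum is not yet known to be positive: that will follow from the distance
        bound, whose proof uses this estimate. If it is 0, then 1 / 0 = 0 and the row sum is
        0.\<close>
      have "0 \<le> (\<Sum>j\<in>I. \<psi> i j t)" using \<psi> i t by (intro sum_nonneg)
      then have "(\<Sum>j\<in>I. w i j t) \<le> 1"
        using M\<psi>_le unfolding eq 2 by (auto simp: divide_simps)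
      then show ?thesis unfolding B_def by simp
    qed
  qed
  have ac: "abs_continuous_on {a..b} (x i)" if "i \<in> I" "0 \<le> a" for i a b
    using assms(3) that unfolding caratheodory_solution_def locally_abs_continuous_on_def I_def by auto
  \<comment> \<open>The free bound s avoids a circle: the row sum bound presupposes bounded
    distances, and the bound R on the distances rests on the maximum principle, hence on a row sum
    bound. First s is a crude bound on {0..t}, later it is R.\<close>
  have flow: "consensus_flow I w (\<lambda>i t. v \<bullet> x i t) a b (B s)"
    if "0 \<le> a" "a \<le> b" and dist: "\<And>i j t. i \<in> I \<Longrightarrow> j \<in> I \<Longrightarrow> t \<in> {a..b} \<Longrightarrow> norm (x i t - x j t) \<le> s"
    for v a b s
  proof
    fix i assume i: "i \<in> I"
    show "(\<Sum>j\<in>I. w i j t) \<le> B s" if "t \<in> {a..b}" for t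
      using i that \<open>0 \<le> a\<close> dist by (intro w_sum) auto
    show "abs_continuous_on {a..b} (\<lambda>t. v \<bullet> x i t)"
    proof (rule abs_continuous_on_dominated[OF ac[OF i \<open>0 \<le> a\<close>], of "norm v" 0])
      fix t u
      have "dist (v \<bullet> x i t) (v \<bullet> x i u) = \<bar>v \<bullet> (x i t - x i u)\<bar>"
        by (simp add: dist_real_def inner_diff_right)
      also have "\<dots> \<le> norm v * dist (x i t) (x i u)"
        unfolding dist_norm by (rule Cauchy_Schwarz_ineq2)
      finally show "dist (v \<bullet> x i t) (v \<bullet> x i u) \<le> norm v * dist (x i t) (x i u) + 0 * (u - t)" by simp
    qed auto
    have "AE t in lebesgue. t \<ge> 0 \<longrightarrow> (x i has_vector_derivative
        (lam i t / real N) *\<^sub>R (\<Sum>j=1..N. (M i j t * \<phi> (norm (x i t - x j t))) *\<^sub>R (x j t - x i t)))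
          (at t within {0..})"
      using assms(3) i unfolding caratheodory_solution_def I_def by blast
    then show "AE t in lebesgue. t \<in> {a..b} \<longrightarrow> ((\<lambda>t. v \<bullet> x i t) has_real_derivative
        (\<Sum>j\<in>I. w i j t * (v \<bullet> x j t - v \<bullet> x i t))) (at t within {a..b})"
    proof (rule eventually_mono, intro impI)
      fix t
      let ?D = "(lam i t / real N) *\<^sub>R (\<Sum>j=1..N. (M i j t * \<phi> (norm (x i t - x j t))) *\<^sub>R (x j t - x i t))"
      assume "t \<ge> 0 \<longrightarrow> (x i has_vector_derivative ?D) (at t within {0..})" "t \<in> {a..b}"
      then have "(x i has_vector_derivative ?D) (at t within {0..})" using \<open>0 \<le> a\<close> by auto
      then have "(x i has_vector_derivative ?D) (at t within {a..b})"
        by (rule has_vector_derivative_within_subset) (use \<open>0 \<le> a\<close> in auto)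
      then have "((\<lambda>t. v \<bullet> x i t) has_vector_derivative v \<bullet> ?D) (at t within {a..b})"
        by (rule bounded_linear.has_vector_derivative[OF bounded_linear_inner_right])
      moreover have "v \<bullet> ?D = (\<Sum>j\<in>I. w i j t * (v \<bullet> x j t - v \<bullet> x i t))"
        unfolding w_def \<psi>_def I_def
        by (simp add: inner_sum_right inner_diff_right sum_distrib_left mult.assoc)
      ultimately show "((\<lambda>t. v \<bullet> x i t) has_real_derivative
          (\<Sum>j\<in>I. w i j t * (v \<bullet> x j t - v \<bullet> x i t))) (at t within {a..b})"
        by (simp add: has_real_derivative_iff_has_vector_derivative)
    qed
  qed (use \<open>finite I\<close> w_nonneg that in auto)
  have dist_le: "norm (x i t - x j t) \<le> R" if ij: "i \<in> I" "j \<in> I" and "t \<ge> 0" for i j t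
  proof -
    \<comment> \<open>Continuity on {0..t} yields a finite s, possibly depending on t.\<close>
    have "compact ((\<lambda>s. x k s - x l s) ` {0..t})" if "k \<in> I" "l \<in> I" for k l
      by (intro compact_continuous_image continuous_on_diff compact_Icc
          abs_continuous_on_imp_continuous_on ac that order_refl)
    then have "bounded (\<Union>k\<in>I. \<Union>l\<in>I. (\<lambda>s. x k s - x l s) ` {0..t})"
      using \<open>finite I\<close> by (intro bounded_UN ballI compact_imp_bounded)
    then obtain s where s: "\<And>k l u. k \<in> I \<Longrightarrow> l \<in> I \<Longrightarrow> u \<in> {0..t} \<Longrightarrow> norm (x k u - x l u) \<le> s"
      unfolding bounded_iff by blast
    \<comment> \<open>The direction is frozen at the final time t: there the difference of the
      projections is the square of norm v, while at time 0 it is at most norm v * R.\<close>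
    define v where "v = x i t - x j t"
    interpret consensus_flow I w "\<lambda>i t. v \<bullet> x i t" 0 t "B s"
      using \<open>t \<ge> 0\<close> s by (intro flow) auto
    have "v \<bullet> x i t - v \<bullet> x j t \<le> norm v * R"
    proof (rule spread_le[OF _ ij])
      fix k l assume kl: "k \<in> I" "l \<in> I"
      have "v \<bullet> x k 0 - v \<bullet> x l 0 \<le> norm v * norm (x k 0 - x l 0)"
        using norm_cauchy_schwarz[of v "x k 0 - x l 0"] by (simp add: inner_diff_right)
      also have "x k 0 - x l 0 = xbar k - xbar l"
        using assms(3) kl unfolding caratheodory_solution_def I_def by simp
      also have "norm (xbar k - xbar l) \<le> R"
        unfolding R_def max_dist_def using kl unfolding I_def
        by (intro Max_ge) (auto intro!: image_eqI[of _ _ "(k, l)"])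
      finally show "v \<bullet> x k 0 - v \<bullet> x l 0 \<le> norm v * R" by (simp add: mult_left_mono)
    qed (use \<open>t \<ge> 0\<close> in auto)
    then have "norm v * norm v \<le> norm v * R"
      by (simp add: v_def flip: inner_diff_right norm_eq_sqrt_inner power2_norm_eq_inner power2_eq_square)
    \<comment> \<open>That is, R \<ge> 0, which settles the case v = 0.\<close>
    moreover have "R \<ge> norm (xbar 1 - xbar 1)"
      unfolding R_def max_dist_def using \<open>1 \<in> I\<close> unfolding I_def
      by (intro Max_ge) (auto intro!: image_eqI[of _ _ "(1, 1)"])
    ultimately show ?thesis unfolding v_def[symmetric] by (cases "v = 0") auto
  qed
  \<comment> \<open>Combines \<psi> \<ge> pm with lam i t / N \<ge> 1 / (N * B R). The latter holds
    for fixed weights because B R \<ge> 1, and for rescaled ones because a row of \<psi> sums to at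
    most N * B R.\<close>
  define c where "c = pm / (real N * B R)"
  have "B R \<ge> 1" unfolding B_def by simp
  have "c > 0" unfolding c_def using \<open>pm > 0\<close> \<open>B R \<ge> 1\<close> \<open>real N > 0\<close> by (intro divide_pos_pos mult_pos_pos) auto
  have w_lower: "c * M i j t \<le> w i j t" if ij: "i \<in> I" "j \<in> I" and t: "t \<ge> 0" for i j t
  proof -
    have \<psi>_ge: "pm \<le> \<psi> i k t" if "k \<in> I" for k
      unfolding \<psi>_def using dist_le[OF ij(1) that t] by (intro pm_le) auto
    have "(\<Sum>k\<in>I. \<psi> i k t) \<le> real (card I) * B R"
      using dist_le ij(1) t unfolding \<psi>_def by (intro sum_bounded_above phi_le) auto
    then have "(\<Sum>k\<in>I. \<psi> i k t) \<le> real N * B R" unfolding I_def by simp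
    moreover have "0 < (\<Sum>k\<in>I. \<psi> i k t)"
      using \<psi>_ge \<open>pm > 0\<close> \<open>finite I\<close> ij(1) by (intro sum_pos) (auto intro: less_le_trans)
    moreover have "real N \<le> real N * B R" using \<open>B R \<ge> 1\<close> \<open>real N > 0\<close> by simp
    ultimately have "1 / (real N * B R) \<le> lam i t / real N"
      using lam[OF ij(1) t] \<open>real N > 0\<close> \<open>B R \<ge> 1\<close> by (auto intro!: divide_left_mono mult_pos_pos)
    moreover have "M i j t * pm \<le> M i j t * \<psi> i j t"
      using \<psi>_ge[OF ij(2)] M[OF ij t] by (intro mult_left_mono)
    ultimately have "1 / (real N * B R) * (M i j t * pm) \<le> w i j t"
      unfolding w_def
    proof (rule mult_mono)
      have "0 \<le> 1 / (real N * B R)" using \<open>B R \<ge> 1\<close> by simp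
      also have "\<dots> \<le> lam i t / real N" by fact
      finally show "0 \<le> lam i t / real N" .
      show "0 \<le> M i j t * pm" using M[OF ij t] \<open>pm > 0\<close> by simp
    qed
    then show ?thesis unfolding c_def by (simp add: mult.commute)
  qed
  \<comment> \<open>The witness is \<alpha> = c * M i j, so that only M i j is integrated and w i j
    is merely compared with it.\<close>
  have excited: "\<exists>\<alpha> J. (\<alpha> has_integral J) {t..t + T} \<and> J \<ge> c * \<mu> \<and> (\<forall>s\<in>{t..t + T}. 0 \<le> \<alpha> s \<and> \<alpha> s \<le> w i j s)"
    if ij: "i \<in> I" "j \<in> I" and t: "t \<ge> 0" for i j t
  proof -
    let ?J = "LINT s:{t..t + T}|lebesgue. M i j s"
    have J: "?J \<ge> \<mu>"
      using assms(11) ij t unfolding persistently_excited_def I_def by blast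
    \<comment> \<open>The Bochner integral of a non-integrable function is 0.\<close>
    then have "set_integrable lebesgue {t..t + T} (M i j)"
      using \<open>\<mu> > 0\<close> not_integrable_integral_eq
      unfolding set_integrable_def set_lebesgue_integral_def by fastforce
    then have "(M i j has_integral ?J) {t..t + T}" by (rule has_integral_set_lebesgue)
    then have "((\<lambda>s. c * M i j s) has_integral c * ?J) {t..t + T}" by (rule has_integral_mult_right)
    moreover have "c * \<mu> \<le> c * ?J" using J \<open>c > 0\<close> by simp
    moreover have "0 \<le> c * M i j s \<and> c * M i j s \<le> w i j s" if "s \<in> {t..t + T}" for s
      using that t ij M[of i j s] w_lower[of i j s] \<open>c > 0\<close> by simp
    ultimately show ?thesis by blast
  qed
  have "((\<lambda>t. x i t - x j t) \<longlongrightarrow> 0) at_top" if ij: "i \<in> I" "j \<in> I" for i j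
  \<comment> \<open>Each coordinate is a scalar flow, now with the row sum bound B R valid for all
    times.\<close>
  proof (subst tendsto_componentwise_iff, intro ballI)
    fix v :: "real ^ 'd"
    have "((\<lambda>t. v \<bullet> x i t - v \<bullet> x j t) \<longlongrightarrow> 0) at_top"
    proof (rule consensus_flow_tendsto[OF _ \<open>T > 0\<close> _ excited ij])
      show "consensus_flow I w (\<lambda>i t. v \<bullet> x i t) a b (B R)" if "0 \<le> a" "a \<le> b" for a b
        using that dist_le by (intro flow) auto
    qed (use \<open>c > 0\<close> \<open>\<mu> > 0\<close> in auto)
    then show "((\<lambda>t. (x i t - x j t) \<bullet> v) \<longlongrightarrow> 0 \<bullet> v) at_top"
      by (simp add: inner_diff_right inner_commute)
  qed
  then show ?thesis unfolding I_def by blast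
qed

end
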